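(* Let $n\in\mathbb{N}$. Let $\Omega_1\in\tau_s(\mathbb{H}_s^n)$ be real-path-connected, let $\Omega_2\in\tau_s(\mathbb{H}_s^n)$ be $\Omega_1$-stem-preserving, and let $f\in\mathcal{SR}(\Omega_1)$ and $g\in\mathcal{SR}(\Omega_2)$. Then the $*$-product $f*g:\Omega_1\to\mathbb{H}$ is (weakly) slice regular, i.e. $f*g\in\mathcal{SR}(\Omega_1)$.
   Context: $\mathbb{H}$ is the algebra of quaternions, $\mathbb{S}:=\{I\in\mathbb{H}: I^2=-1\}$, and for $I\in\mathbb{S}$, $\mathbb{C}_I:=\mathbb{R}+\mathbb{R}I$, $\mathbb{C}_I^n:=(\mathbb{C}_I)^n$. The weakly slice cone is $\mathbb{H}_s^n:=\bigcup_{I\in\mathbb{S}}\mathbb{C}_I^n\subset\mathbb{H}^n$. For $\Omega\subset\mathbb{H}_s^n$ put $\Omega_I:=\Omega\cap\mathbb{C}_I^n$. The slice topology $\tau_s(\mathbb{H}_s^n)$ consists of all $\Omega\subset\mathbb{H}_s^n$ such that $\Omega_I$ is open in $\mathbb{C}_I^n$ (Euclidean topology) for every $I\in\mathbb{S}$. For $z=x+yi\in\mathbb{C}^n$ ($x,y\in\mathbb{R}^n$) and $I\in\mathbb{S}$, $z^I:=x+yI\in\mathbb{C}_I^n$; for a path $\gamma:[0,1]\to\mathbb{C}^n$, $\gamma^I(t):=(\gamma(t))^I$. $\mathscr{P}(\mathbb{C}^n)$ is the set of continuous $\gamma:[0,1]\to\mathbb{C}^n$ with $\gamma(0)\in\mathbb{R}^n$.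 Writing $\gamma^I\subset\Omega$ for $\gamma^I([0,1])\subset\Omega$, set $\mathbb{S}(\Omega,\gamma):=\{I\in\mathbb{S}:\gamma^I\subset\Omega\}$ and $\mathscr{P}(\mathbb{C}^n,\Omega):=\{\gamma\in\mathscr{P}(\mathbb{C}^n):\mathbb{S}(\Omega,\gamma)\neq\varnothing\}$. $\Omega\subset\mathbb{H}_s^n$ is real-path-connected if for each $q\in\Omega$ there are $\gamma\in\mathscr{P}(\mathbb{C}^n,\Omega)$ and $I\in\mathbb{S}(\Omega,\gamma)$ with $\gamma^I(1)=q$. $\Omega_2\subset\mathbb{H}_s^n$ is $\Omega_1$-stem-preserving if (i) $|\mathbb{S}(\Omega_2,\gamma)|\geq 2$ for every $\gamma\in\mathscr{P}(\mathbb{C}^n,\Omega_1)$, and (ii) $|\mathbb{S}(\Omega_2,\alpha)\cap\mathbb{S}(\Omega_2,\beta)|\neq 1$ for all $\alpha,\beta\in\mathscr{P}(\mathbb{C}^n,\Omega_1)$ with $\alpha(1)=\beta(1)$. Slice regular functions: for $\Omega\in\tau_s(\mathbb{H}_s^n)$, $f:\Omega\to\mathbb{H}$ is (weakly) slice regular if for every $I\in\mathbb{S}$ the restriction $f_I:=f|_{\Omega_I}$ is real differentiable and $\frac12\left(\frac{\partial}{\partial x_\ell}+I\frac{\partial}{\partial y_\ell}\right)f_I(x+yI)=0$ on $\Omega_I$ for each $\ell=1,\dots,n$. The set of these is $\mathcal{SR}(\Omega)$. Path-slice functions: $f:\Omega\to\mathbb{H}$ ($\Omega\subset\mathbb{H}_s^n$)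 is path-slice if there is $F:\mathscr{P}(\mathbb{C}^n,\Omega)\to\mathbb{H}^{2\times1}$ (a path-slice stem function of $f$) with $f(\gamma^I(1))=(1,I)F(\gamma)$ for all $\gamma\in\mathscr{P}(\mathbb{C}^n,\Omega)$, $I\in\mathbb{S}(\Omega,\gamma)$. The set of path-slice functions is $\mathcal{PS}(\Omega)$. It is a known fact that $\mathcal{SR}(\Omega)\subset\mathcal{PS}(\Omega)$ for $\Omega\in\tau_s(\mathbb{H}_s^n)$. If $\Omega_2$ is $\Omega_1$-stem-preserving with $\Omega_1$ real-path-connected and $g\in\mathcal{PS}(\Omega_2)$, then $F_{\Omega_1}^g:\mathscr{P}(\mathbb{C}^n,\Omega_1)\to\mathbb{H}^{2\times1}$ denotes $G|_{\mathscr{P}(\mathbb{C}^n,\Omega_1)}$ for any path-slice stem function $G$ of $g$ (known to be independent of $G$). Define $\mathfrak{I}:\mathbb{H}_s^n\to\mathbb{S}\cup\{0\}$ by $\mathfrak{I}(q)=0$ if $q\in\mathbb{R}^n$, and otherwise $\mathfrak{I}(q)=\frac{q_\imath-\mathrm{Re}(q_\imath)}{|q_\imath-\mathrm{Re}(q_\imath)|}$, where $\imath$ is the smallest index with $q_\imath\notin\mathbb{R}$. For $q\in\Omega_1$ let $\mathscr{F}_{\Omega_1}^g(q):=(g(q),0)^T$ if $q\in\mathbb{R}^n$, and $\mathscr{F}_{\Omega_1}^g(q):=F_{\Omega_1}^g(\gamma)$ if $q\notin\mathbb{R}^n$, where $\gamma\in\mathscr{P}(\mathbb{C}^n,\Omega_1)$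 is any path with $\gamma^{\mathfrak{I}(q)}\subset\Omega_1$ and $\gamma^{\mathfrak{I}(q)}(1)=q$ (known to be well defined). For $f\in\mathcal{PS}(\Omega_1)$ and $g\in\mathcal{PS}(\Omega_2)$ the $*$-product is $f*g:\Omega_1\to\mathbb{H}$, $(f*g)(q):=\big(f(q),\mathfrak{I}(q)f(q)\big)\,\mathscr{F}_{\Omega_1}^g(q)$ (row times column). *)

theory Defs
  imports "HOL-Analysis.Analysis"
begin

section \<open>The quaternions\<close>

datatype quat = Quat (qre: real) (qim1: real) (qim2: real) (qim3: real)

lemma quat_eq_iff:
  "p = q \<longleftrightarrow> qre p = qre q \<and> qim1 p = qim1 q \<and> qim2 p = qim2 q \<and> qim3 p = qim3 q"
  by (cases p; cases q) simp

instantiation quat :: ring_1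
begin

definition zero_quat :: quat where "0 = Quat 0 0 0 0"

definition one_quat :: quat where "1 = Quat 1 0 0 0"

definition plus_quat :: "quat \<Rightarrow> quat \<Rightarrow> quat" where
  "p + q = Quat (qre p + qre q) (qim1 p + qim1 q) (qim2 p + qim2 q) (qim3 p + qim3 q)"

definition uminus_quat :: "quat \<Rightarrow> quat" where
  "- p = Quat (- qre p) (- qim1 p) (- qim2 p) (- qim3 p)"

definition minus_quat :: "quat \<Rightarrow> quat \<Rightarrow> quat" where
  "p - q = Quat (qre p - qre q) (qim1 p - qim1 q) (qim2 p - qim2 q) (qim3 p - qim3 q)"

definition times_quat :: "quat \<Rightarrow> quat \<Rightarrow> quat" where
  "p * q = Quat
     (qre p * qre q - qim1 p * qim1 q - qim2 p * qim2 q - qim3 p * qim3 q)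
     (qre p * qim1 q + qim1 p * qre q + qim2 p * qim3 q - qim3 p * qim2 q)
     (qre p * qim2 q - qim1 p * qim3 q + qim2 p * qre q + qim3 p * qim1 q)
     (qre p * qim3 q + qim1 p * qim2 q - qim2 p * qim1 q + qim3 p * qre q)"

instance
  by standard
    (simp_all add: quat_eq_iff zero_quat_def one_quat_def plus_quat_def uminus_quat_def
       minus_quat_def times_quat_def algebra_simps)

end

lemma quat_sel_simps [simp]:
  "qre 0 = 0" "qim1 0 = 0" "qim2 0 = 0" "qim3 0 = 0"
  "qre 1 = 1" "qim1 1 = 0" "qim2 1 = 0" "qim3 1 = 0"
  "qre (p + q) = qre p + qre q" "qim1 (p + q) = qim1 p + qim1 q"
  "qim2 (p + q) = qim2 p + qim2 q" "qim3 (p + q) = qim3 p + qim3 q"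
  "qre (- p) = - qre p" "qim1 (- p) = - qim1 p"
  "qim2 (- p) = - qim2 p" "qim3 (- p) = - qim3 p"
  "qre (p - q) = qre p - qre q" "qim1 (p - q) = qim1 p - qim1 q"
  "qim2 (p - q) = qim2 p - qim2 q" "qim3 (p - q) = qim3 p - qim3 q"
  by (simp_all add: zero_quat_def one_quat_def plus_quat_def uminus_quat_def minus_quat_def)

lemma quat_mult_sel:
  "qre (p * q) = qre p * qre q - qim1 p * qim1 q - qim2 p * qim2 q - qim3 p * qim3 q"
  "qim1 (p * q) = qre p * qim1 q + qim1 p * qre q + qim2 p * qim3 q - qim3 p * qim2 q"
  "qim2 (p * q) = qre p * qim2 q - qim1 p * qim3 q + qim2 p * qre q + qim3 p * qim1 q"
  "qim3 (p * q) = qre p * qim3 q + qim1 p * qim2 q - qim2 p * qim1 q + qim3 p * qre q"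
  by (simp_all add: times_quat_def)

instantiation quat :: real_algebra_1
begin

definition scaleR_quat :: "real \<Rightarrow> quat \<Rightarrow> quat" where
  "r *\<^sub>R p = Quat (r * qre p) (r * qim1 p) (r * qim2 p) (r * qim3 p)"

instance
  by standard
    (simp_all add: quat_eq_iff scaleR_quat_def quat_mult_sel algebra_simps)

end

lemma quat_scaleR_sel [simp]:
  "qre (r *\<^sub>R p) = r * qre p" "qim1 (r *\<^sub>R p) = r * qim1 p"
  "qim2 (r *\<^sub>R p) = r * qim2 p" "qim3 (r *\<^sub>R p) = r * qim3 p"
  by (simp_all add: scaleR_quat_def)

text \<open>The norm is the Euclidean norm of \<open>R^4\<close>.\<close>

instantiation quat :: real_normed_vector
begin

definition norm_quat :: "quat \<Rightarrow> real" where
  "norm p = sqrt ((qre p)\<^sup>2 + (qim1 p)\<^sup>2 + (qim2 p)\<^sup>2 + (qim3 p)\<^sup>2)"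

definition sgn_quat :: "quat \<Rightarrow> quat" where
  "sgn (p :: quat) = p /\<^sub>R norm p"

definition dist_quat :: "quat \<Rightarrow> quat \<Rightarrow> real" where
  "dist (p :: quat) q = norm (p - q)"

definition uniformity_quat :: "(quat \<times> quat) filter" where
  "(uniformity :: (quat \<times> quat) filter) = (INF e\<in>{0 <..}. principal {(p, q). dist p q < e})"

definition open_quat :: "quat set \<Rightarrow> bool" where
  "open (U :: quat set) \<longleftrightarrow> (\<forall>p\<in>U. eventually (\<lambda>(p', q). p' = p \<longrightarrow> q \<in> U) uniformity)"

lemma norm_quat_L2_set:
  "norm p = L2_set (\<lambda>i. [qre p, qim1 p, qim2 p, qim3 p] ! i) {..<4}"
  by (simp add: norm_quat_def L2_set_def numeral_eq_Suc)

instance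
proof
  fix p q :: quat and r :: real and U :: "quat set"
  show "norm p = 0 \<longleftrightarrow> p = 0"
    by (simp add: norm_quat_def quat_eq_iff add_nonneg_eq_0_iff)
  have "norm (p + q) = L2_set (\<lambda>i. [qre p, qim1 p, qim2 p, qim3 p] ! i
      + [qre q, qim1 q, qim2 q, qim3 q] ! i) {..<4}"
    by (simp add: norm_quat_L2_set L2_set_def numeral_eq_Suc)
  also have "\<dots> \<le> norm p + norm q"
    unfolding norm_quat_L2_set by (rule L2_set_triangle_ineq)
  finally show "norm (p + q) \<le> norm p + norm q" .
  show "norm (r *\<^sub>R p) = \<bar>r\<bar> * norm p"
    by (simp add: norm_quat_def power_mult_distrib flip: distrib_left real_sqrt_abs real_sqrt_mult)
qed (simp_all add: sgn_quat_def dist_quat_def uniformity_quat_def open_quat_def)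

end

instantiation quat :: real_inner
begin

definition inner_quat :: "quat \<Rightarrow> quat \<Rightarrow> real" where
  "p \<bullet> q = qre p * qre q + qim1 p * qim1 q + qim2 p * qim2 q + qim3 p * qim3 q"

instance
proof
  fix p q s :: quat and r :: real
  show norm: "norm p = sqrt (p \<bullet> p)"
    by (simp add: norm_quat_def inner_quat_def power2_eq_square)
  show "p \<bullet> q = q \<bullet> p" by (simp add: inner_quat_def)
  show "(p + q) \<bullet> s = p \<bullet> s + q \<bullet> s" by (simp add: inner_quat_def algebra_simps)
  show "(r *\<^sub>R p) \<bullet> q = r * (p \<bullet> q)" by (simp add: inner_quat_def algebra_simps)
  show "0 \<le> p \<bullet> p" by (simp add: inner_quat_def)
  show "p \<bullet> p = 0 \<longleftrightarrow> p = 0"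
    using norm norm_eq_zero[of p] by (metis real_sqrt_eq_zero_cancel_iff)
qed

end

instance quat :: real_normed_algebra_1
proof
  fix p q :: quat
  have sq: "(p * q) \<bullet> (p * q) = (p \<bullet> p) * (q \<bullet> q)"
    by (simp add: inner_quat_def quat_mult_sel algebra_simps)
  show "norm (p * q) \<le> norm p * norm q"
    by (simp add: norm_eq_sqrt_inner sq real_sqrt_mult)
  show "norm (1 :: quat) = 1"
    by (simp add: norm_quat_def)
qed

instantiation quat :: real_normed_div_algebra
begin

definition inverse_quat :: "quat \<Rightarrow> quat" where
  "inverse p = Quat (qre p) (- qim1 p) (- qim2 p) (- qim3 p) /\<^sub>R (p \<bullet> p)"

definition divide_quat :: "quat \<Rightarrow> quat \<Rightarrow> quat" where
  "(p :: quat) div q = p * inverse q"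

instance
proof
  fix p q :: quat
  have conj: "Quat (qre p) (- qim1 p) (- qim2 p) (- qim3 p) * p = (p \<bullet> p) *\<^sub>R 1"
    "p * Quat (qre p) (- qim1 p) (- qim2 p) (- qim3 p) = (p \<bullet> p) *\<^sub>R 1"
    by (simp_all add: quat_eq_iff quat_mult_sel inner_quat_def algebra_simps)
  show "inverse p * p = 1" "p * inverse p = 1" if "p \<noteq> 0"
    using that by (simp_all add: inverse_quat_def conj)
  show "p div q = p * inverse q" by (simp add: divide_quat_def)
  show "inverse (0 :: quat) = 0" by (simp add: inverse_quat_def inner_quat_def)
  have sq: "(p * q) \<bullet> (p * q) = (p \<bullet> p) * (q \<bullet> q)"
    by (simp add: inner_quat_def quat_mult_sel algebra_simps)
  show "norm (p * q) = norm p * norm q"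
    by (simp add: norm_eq_sqrt_inner sq real_sqrt_mult)
qed

end

instantiation quat :: euclidean_space
begin

definition Basis_quat :: "quat set" where
  "Basis = {Quat 1 0 0 0, Quat 0 1 0 0, Quat 0 0 1 0, Quat 0 0 0 1}"

instance
proof
  fix p q :: quat
  show "(Basis :: quat set) \<noteq> {}" "finite (Basis :: quat set)"
    by (simp_all add: Basis_quat_def)
  show "p \<bullet> q = (if p = q then 1 else 0)" if "p \<in> Basis" "q \<in> Basis"
    using that unfolding Basis_quat_def by (elim insertE emptyE) (simp_all add: inner_quat_def)
  show "(\<forall>u\<in>Basis. p \<bullet> u = 0) \<longleftrightarrow> p = 0"
    by (simp add: Basis_quat_def inner_quat_def quat_eq_iff[of p 0])
qed

end


section \<open>The weakly slice cone and the slice topology\<close>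

text \<open>
  Points of \<open>H^n\<close> and \<open>C^n\<close> are vectors indexed by a finite linearly ordered type \<open>'n\<close>, which
  plays the role of \<open>{1,\<dots>,n}\<close>; the order is only needed for ``the smallest index'' in
  \<open>slice_unit\<close> below.
\<close>

definition imag_units :: "quat set" where
  "imag_units = {I. I\<^sup>2 = -1}"

definition slice_plane :: "quat \<Rightarrow> quat set" where
  "slice_plane I = {of_real x + of_real y * I | x y :: real. True}"

definition slice_space :: "quat \<Rightarrow> (quat^'n) set" where
  "slice_space I = {q. \<forall>l. q $ l \<in> slice_plane I}"

definition slice_cone :: "(quat^'n) set" where
  "slice_cone = (\<Union>I\<in>imag_units. slice_space I)"

definition real_points :: "('a::real_algebra_1^'n) set" where
  "real_points = {q. \<forall>l. q $ l \<in> \<real>}"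

definition slice_topology :: "(quat^'n) topology" where
  "slice_topology = topology (\<lambda>\<Omega>. \<Omega> \<subseteq> slice_cone \<and>
     (\<forall>I\<in>imag_units. openin (top_of_set (slice_space I)) (\<Omega> \<inter> slice_space I)))"

lemma openin_slice_topology:
  fixes \<Omega> :: "(quat^'n) set"
  shows "openin slice_topology \<Omega> \<longleftrightarrow> \<Omega> \<subseteq> slice_cone \<and>
     (\<forall>I\<in>imag_units. openin (top_of_set (slice_space I)) (\<Omega> \<inter> slice_space I))"
proof -
  let ?P = "\<lambda>\<Omega> :: (quat^'n) set. \<Omega> \<subseteq> slice_cone \<and>
     (\<forall>I\<in>imag_units. openin (top_of_set (slice_space I)) (\<Omega> \<inter> slice_space I))"
  have "istopology ?P"
    unfolding istopology_def
  proof (intro conjI allI impI)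
    fix S T :: "(quat^'n) set"
    assume S: "?P S" and T: "?P T"
    show "S \<inter> T \<subseteq> slice_cone" using S by blast
    have eq: "S \<inter> T \<inter> slice_space I = (S \<inter> slice_space I) \<inter> (T \<inter> slice_space I)" for I
      by blast
    show "\<forall>I\<in>imag_units. openin (top_of_set (slice_space I)) (S \<inter> T \<inter> slice_space I)"
      using S T by (simp add: eq openin_Int)
  next
    fix K :: "(quat^'n) set set"
    assume K: "\<forall>S\<in>K. ?P S"
    show "\<Union>K \<subseteq> slice_cone" using K by blast
    have eq: "\<Union>K \<inter> slice_space I = \<Union>((\<lambda>S. S \<inter> slice_space I) ` K)" for I
      by blast
    show "\<forall>I\<in>imag_units. openin (top_of_set (slice_space I)) (\<Union>K \<inter> slice_space I)"
    proof
      fix I assume "I \<in> imag_units"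
      then show "openin (top_of_set (slice_space I)) (\<Union>K \<inter> slice_space I)"
        unfolding eq by (intro openin_Union) (use K in blast)
    qed
  qed
  then show ?thesis
    by (simp add: slice_topology_def topology_inverse')
qed


section \<open>Paths\<close>

text \<open>The point \<open>z^I = x + y I\<close> for \<open>z = x + y i\<close>.\<close>

definition to_slice :: "quat \<Rightarrow> complex^'n \<Rightarrow> quat^'n" where
  "to_slice I z = (\<chi> l. of_real (Re (z $ l)) + of_real (Im (z $ l)) * I)"

definition path_to_slice :: "quat \<Rightarrow> (real \<Rightarrow> complex^'n) \<Rightarrow> real \<Rightarrow> quat^'n" where
  "path_to_slice I \<gamma> = (\<lambda>t. to_slice I (\<gamma> t))"

text \<open>Extensionality makes the elements correspond exactly to functions with domain \<open>[0,1]\<close>.\<close>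

definition real_start_paths :: "(real \<Rightarrow> complex^'n) set" where
  "real_start_paths = {\<gamma> \<in> extensional {0..1}. path \<gamma> \<and> pathstart \<gamma> \<in> real_points}"

definition units_along :: "(quat^'n) set \<Rightarrow> (real \<Rightarrow> complex^'n) \<Rightarrow> quat set" where
  "units_along \<Omega> \<gamma> = {I \<in> imag_units. path_image (path_to_slice I \<gamma>) \<subseteq> \<Omega>}"

definition paths_in :: "(quat^'n) set \<Rightarrow> (real \<Rightarrow> complex^'n) set" where
  "paths_in \<Omega> = {\<gamma> \<in> real_start_paths. units_along \<Omega> \<gamma> \<noteq> {}}"

definition real_path_connected :: "(quat^'n) set \<Rightarrow> bool" where
  "real_path_connected \<Omega> \<longleftrightarrow>
     (\<forall>q\<in>\<Omega>. \<exists>\<gamma>\<in>paths_in \<Omega>. \<exists>I\<in>units_along \<Omega> \<gamma>. pathfinish (path_to_slice I \<gamma>) = q)"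

text \<open>
  \<open>stem_preserving \<Omega>\<^sub>1 \<Omega>\<^sub>2\<close>: the set \<open>\<Omega>\<^sub>2\<close> is \<open>\<Omega>\<^sub>1\<close>-stem-preserving.  The sets of units
  may be infinite, in which case \<open>card\<close> is 0; hence the explicit disjunct in the first clause,
  while \<open>card \<dots> \<noteq> 1\<close> is correct as it stands.
\<close>

definition stem_preserving :: "(quat^'n) set \<Rightarrow> (quat^'n) set \<Rightarrow> bool" where
  "stem_preserving \<Omega>\<^sub>1 \<Omega>\<^sub>2 \<longleftrightarrow>
     (\<forall>\<gamma>\<in>paths_in \<Omega>\<^sub>1. infinite (units_along \<Omega>\<^sub>2 \<gamma>) \<or> card (units_along \<Omega>\<^sub>2 \<gamma>) \<ge> 2) \<and>
     (\<forall>\<alpha>\<in>paths_in \<Omega>\<^sub>1. \<forall>\<beta>\<in>paths_in \<Omega>\<^sub>1. pathfinish \<alpha> = pathfinish \<beta> \<longrightarrow>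
        card (units_along \<Omega>\<^sub>2 \<alpha> \<inter> units_along \<Omega>\<^sub>2 \<beta>) \<noteq> 1)"


section \<open>Slice regular and path-slice functions\<close>

text \<open>
  A function on \<open>\<Omega>\<close> is represented by a total function of which only the values on \<open>\<Omega>\<close> matter.
  The restriction \<open>f\<^sub>I\<close> to \<open>\<Omega> \<inter> C_I^n\<close> is expressed in the real coordinates \<open>(x, y)\<close> of
  \<open>x + y I\<close>, i.e. as a function of \<open>z = x + y i\<close> in \<open>C^n\<close>; if \<open>\<Omega>\<close> is open in the slice topology,
  it is defined on an open subset of \<open>C^n\<close>.
\<close>

definition slice_restrict :: "quat \<Rightarrow> (quat^'n \<Rightarrow> quat) \<Rightarrow> complex^'n \<Rightarrow> quat" where
  "slice_restrict I f = (\<lambda>z. f (to_slice I z))"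

definition partial_x :: "'n \<Rightarrow> (complex^'n \<Rightarrow> quat) \<Rightarrow> complex^'n \<Rightarrow> quat" where
  "partial_x l h z = vector_derivative (\<lambda>t. h (z + axis l (of_real t))) (at 0)"

definition partial_y :: "'n \<Rightarrow> (complex^'n \<Rightarrow> quat) \<Rightarrow> complex^'n \<Rightarrow> quat" where
  "partial_y l h z = vector_derivative (\<lambda>t. h (z + axis l (of_real t * \<i>))) (at 0)"

definition slice_regular :: "(quat^'n) set \<Rightarrow> (quat^'n \<Rightarrow> quat) set" where
  "slice_regular \<Omega> = {f. \<forall>I\<in>imag_units. \<forall>z. to_slice I z \<in> \<Omega> \<longrightarrow>
     slice_restrict I f differentiable (at z) \<and>
     (\<forall>l. (1/2) *\<^sub>R (partial_x l (slice_restrict I f) z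
                     + I * partial_y l (slice_restrict I f) z) = 0)}"

text \<open>Row \<open>(a, b)\<close> times column \<open>(c, d)\<close>; both are represented as pairs.\<close>

fun row_times_col :: "quat \<times> quat \<Rightarrow> quat \<times> quat \<Rightarrow> quat" where
  "row_times_col (a, b) (c, d) = a * c + b * d"

definition path_slice_stem ::
    "(quat^'n) set \<Rightarrow> (quat^'n \<Rightarrow> quat) \<Rightarrow> ((real \<Rightarrow> complex^'n) \<Rightarrow> quat \<times> quat) \<Rightarrow> bool" where
  "path_slice_stem \<Omega> f F \<longleftrightarrow>
     (\<forall>\<gamma>\<in>paths_in \<Omega>. \<forall>I\<in>units_along \<Omega> \<gamma>.
        f (pathfinish (path_to_slice I \<gamma>)) = row_times_col (1, I) (F \<gamma>))"

definition path_slice :: "(quat^'n) set \<Rightarrow> (quat^'n \<Rightarrow> quat) set" where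
  "path_slice \<Omega> = {f. \<exists>F. path_slice_stem \<Omega> f F}"


section \<open>The star product\<close>

text \<open>
  The choices by \<open>SOME\<close> below are those called arbitrary in the definition of the product: when
  \<open>\<Omega>\<^sub>1\<close> is real-path-connected, \<open>\<Omega>\<^sub>2\<close> is \<open>\<Omega>\<^sub>1\<close>-stem-preserving and \<open>g\<close> is path-slice on
  \<open>\<Omega>\<^sub>2\<close>, the results do not depend on them.
\<close>

definition stem_on ::
    "(quat^'n) set \<Rightarrow> (quat^'n) set \<Rightarrow> (quat^'n \<Rightarrow> quat) \<Rightarrow> (real \<Rightarrow> complex^'n) \<Rightarrow> quat \<times> quat" where
  "stem_on \<Omega>\<^sub>1 \<Omega>\<^sub>2 g = restrict (SOME G. path_slice_stem \<Omega>\<^sub>2 g G) (paths_in \<Omega>\<^sub>1)"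

definition slice_unit :: "quat^('n::{finite,linorder}) \<Rightarrow> quat" where
  "slice_unit q = (if q \<in> real_points then 0
     else let p = q $ Min {l. q $ l \<notin> \<real>}
          in (p - of_real (qre p)) /\<^sub>R norm (p - of_real (qre p)))"

definition stem_at ::
    "(quat^('n::{finite,linorder})) set \<Rightarrow> (quat^('n::{finite,linorder})) set
      \<Rightarrow> (quat^('n::{finite,linorder}) \<Rightarrow> quat) \<Rightarrow> quat^('n::{finite,linorder}) \<Rightarrow> quat \<times> quat"
  where
  "stem_at \<Omega>\<^sub>1 \<Omega>\<^sub>2 g q =
     (if q \<in> real_points then (g q, 0)
      else stem_on \<Omega>\<^sub>1 \<Omega>\<^sub>2 g
        (SOME \<gamma>. \<gamma> \<in> paths_in \<Omega>\<^sub>1 \<and> path_image (path_to_slice (slice_unit q) \<gamma>) \<subseteq> \<Omega>\<^sub>1 \<and>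
           pathfinish (path_to_slice (slice_unit q) \<gamma>) = q))"

definition star_product ::
    "(quat^('n::{finite,linorder})) set \<Rightarrow> (quat^('n::{finite,linorder})) set
      \<Rightarrow> (quat^('n::{finite,linorder}) \<Rightarrow> quat) \<Rightarrow> (quat^('n::{finite,linorder}) \<Rightarrow> quat)
      \<Rightarrow> quat^('n::{finite,linorder}) \<Rightarrow> quat" where
  "star_product \<Omega>\<^sub>1 \<Omega>\<^sub>2 f g q =
     row_times_col (f q, slice_unit q * f q) (stem_at \<Omega>\<^sub>1 \<Omega>\<^sub>2 g q)"

end

theory Submission
  imports Defs "HOL-Complex_Analysis.Conformal_Mappings"
begin

text \<open>
  The star product is the product of \<open>f\<close> with the stem of \<open>g\<close>, read off in the slice of the point.
  Slice regularity is a local condition in each slice, so it is enough to find, near every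
  \<open>z\<^sup>I \<in> \<Omega>\<^sub>1\<close>, a formula for the product that visibly solves the Cauchy--Riemann equations.

  Choose a path \<open>\<gamma>\<close> from a real point to \<open>z\<close> with \<open>\<gamma>\<^sup>I\<close> in \<open>\<Omega>\<^sub>1\<close>.  Stem preservation gives two
  units \<open>J \<noteq> K\<close> along which \<open>\<gamma>\<close> lies in \<open>\<Omega>\<^sub>2\<close>.  For \<open>w\<close> near \<open>z\<close>, extending \<open>\<gamma>\<close> by the segment
  from \<open>z\<close> to \<open>w\<close> keeps all three lifts inside, so the stem \<open>(c, d)\<close> of \<open>g\<close> at \<open>w\<close> is the solution of
  \<open>c + J d = g (w\<^sup>J)\<close>, \<open>c + K d = g (w\<^sup>K)\<close> (\<open>stem_re\<close>, \<open>stem_im\<close>), and the star product at \<open>w\<^sup>I\<close>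
  is \<open>f (w\<^sup>I) c + I f (w\<^sup>I) d\<close> (\<open>star_product_along_path\<close>).  Since \<open>g\<close> is holomorphic in the slices
  of \<open>J\<close> and \<open>K\<close>, the pair \<open>c + i d\<close> is holomorphic in the usual sense, and the product rule gives
  the Cauchy--Riemann equations for the product (\<open>left_holomorphic_stem_product\<close>).

  Two facts make the formula meaningful.  First, \<open>g\<close> has a stem: along a path, the value of \<open>g\<close>
  at \<open>z\<^sup>I\<close> is determined by the values at \<open>z\<^sup>J\<close> and \<open>z\<^sup>K\<close>, because the difference of the two sides
  is holomorphic and vanishes at real points (\<open>slice_regular_representation\<close>).  Secondly, the stem at
  the endpoint of \<open>\<gamma>\<close> is independent of \<open>\<gamma>\<close>: two paths with the same endpoint that lie in \<open>\<Omega>\<^sub>1\<close> along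
  a common unit can be joined, the second one reversed, to a single path, and the two units which
  stem preservation provides for the joined path serve both (\<open>path_slice_stem_endpoint\<close>).
\<close>

section \<open>Imaginary units and slices\<close>

lemma imag_unit_square: "I \<in> imag_units \<Longrightarrow> I * I = -1"
  by (simp add: imag_units_def power2_eq_square)

lemma imag_unit_square_left: "I \<in> imag_units \<Longrightarrow> I * (I * q) = - q"
  by (simp add: imag_unit_square flip: mult.assoc)

lemma uminus_imag_unit: "I \<in> imag_units \<Longrightarrow> - I \<in> imag_units"
  by (simp add: imag_units_def)

lemma norm_imag_unit: "I \<in> imag_units \<Longrightarrow> norm I = 1"
  using norm_mult[of I I] imag_unit_square[of I] norm_ge_zero[of I]
  by (simp add: square_eq_1_iff)

lemma of_real_quat_sel [simp]:
  "qre (of_real x) = x" "qim1 (of_real x) = 0" "qim2 (of_real x) = 0" "qim3 (of_real x) = 0"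
  by (simp_all add: of_real_def)

lemma qre_imag_unit: "I \<in> imag_units \<Longrightarrow> qre I = 0"
proof (rule ccontr)
  assume I: "I \<in> imag_units" and r: "qre I \<noteq> 0"
  have "qim1 I = 0" "qim2 I = 0" "qim3 I = 0"
    and "qre I * qre I - qim1 I * qim1 I - qim2 I * qim2 I - qim3 I * qim3 I = -1"
    using imag_unit_square[OF I] r by (auto simp: quat_eq_iff quat_mult_sel)
  then have "qre I * qre I = -1"
    by simp
  then show False
    using zero_le_square[of "qre I"] by linarith
qed

definition cnj_vec :: "complex^'n \<Rightarrow> complex^'n" where
  "cnj_vec z = (\<chi> l. cnj (z $ l))"

lemma to_slice_uminus: "to_slice (- I) z = to_slice I (cnj_vec z)"
  by (simp add: to_slice_def cnj_vec_def)

lemma cnj_vec_cnj_vec [simp]: "cnj_vec (cnj_vec z) = z"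
  by (simp add: cnj_vec_def vec_eq_iff)

lemma continuous_on_cnj_vec: "continuous_on S cnj_vec"
  unfolding cnj_vec_def by (intro continuous_intros)

lemma real_points_cnj_vec: "z \<in> real_points \<Longrightarrow> cnj_vec z = z"
  by (simp add: cnj_vec_def real_points_def vec_eq_iff complex_eq_iff complex_is_Real_iff)

lemma to_slice_real:
  assumes "z \<in> real_points"
  shows "to_slice I z = to_slice J z"
proof -
  have "Im (z $ l) = 0" for l
    using assms by (auto simp: real_points_def complex_is_Real_iff)
  then show ?thesis
    by (simp add: to_slice_def)
qed

lemma to_slice_coord_eq_iff:
  assumes "I \<in> imag_units"
  shows "of_real x + of_real y * I = of_real x' + of_real y' * I \<longleftrightarrow> x = x' \<and> y = y'"
proof
  assume eq: "of_real x + of_real y * I = of_real x' + of_real y' * I"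
  have "x = x'"
    using arg_cong[OF eq, of qre] qre_imag_unit[OF assms] by (simp add: quat_mult_sel)
  with eq have "of_real (y - y') * I = 0"
    by (simp add: algebra_simps)
  with \<open>x = x'\<close> norm_imag_unit[OF assms] show "x = x' \<and> y = y'"
    by (auto simp del: of_real_diff)
qed simp

lemma to_slice_eq_iff: "I \<in> imag_units \<Longrightarrow> to_slice I z = to_slice I w \<longleftrightarrow> z = w"
  by (auto simp: to_slice_def vec_eq_iff to_slice_coord_eq_iff complex_eq_iff)

lemma to_slice_coord_real_iff:
  assumes "I \<in> imag_units"
  shows "to_slice I z $ l \<in> \<real> \<longleftrightarrow> z $ l \<in> \<real>"
proof -
  have "of_real x + of_real y * I \<in> \<real> \<longleftrightarrow> y = 0" for x y
  proof
    assume "of_real x + of_real y * I \<in> \<real>"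
    then obtain r where "of_real x + of_real y * I = of_real r + of_real 0 * I"
      by (auto elim: Reals_cases)
    then show "y = 0"
      using to_slice_coord_eq_iff[OF assms] by blast
  qed simp
  then show ?thesis
    by (simp add: to_slice_def complex_is_Real_iff)
qed

lemma to_slice_real_points_iff:
  "I \<in> imag_units \<Longrightarrow> to_slice I z \<in> real_points \<longleftrightarrow> z \<in> real_points"
  by (simp add: real_points_def to_slice_coord_real_iff)

text \<open>
  Dividing \<open>y I\<close> by its norm leaves the sign of \<open>y\<close>.  Hence the unit that the star product uses at a
  non-real point of the slice of \<open>I\<close> may be \<open>- I\<close>, and the comparison with \<open>I\<close> needs conjugate
  paths.
\<close>

lemma slice_unit_to_slice:
  fixes z :: "complex^('n::{finite,linorder})"
  assumes I: "I \<in> imag_units" and z: "z \<notin> real_points"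
  shows "slice_unit (to_slice I z) \<in> {I, - I}"
proof -
  define l where "l = Min {l. to_slice I z $ l \<notin> \<real>}"
  have "l \<in> {l. to_slice I z $ l \<notin> \<real>}"
    unfolding l_def using z I
    by (intro Min_in) (auto simp: real_points_def to_slice_coord_real_iff)
  then have y: "Im (z $ l) \<noteq> 0"
    using I by (simp add: to_slice_coord_real_iff complex_is_Real_iff)
  have coord: "to_slice I z $ l - of_real (qre (to_slice I z $ l)) = Im (z $ l) *\<^sub>R I"
    using qre_imag_unit[OF I] by (simp add: to_slice_def quat_mult_sel scaleR_conv_of_real)
  have "slice_unit (to_slice I z) = (Im (z $ l) *\<^sub>R I) /\<^sub>R norm (Im (z $ l) *\<^sub>R I)"
    using z I by (simp add: slice_unit_def to_slice_real_points_iff Let_def coord flip: l_def)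
  also have "\<dots> = sgn (Im (z $ l)) *\<^sub>R I"
    using norm_imag_unit[OF I] by (simp add: sgn_div_norm)
  finally show ?thesis
    using y by (auto simp: sgn_if)
qed

lemma continuous_on_to_slice: "continuous_on S (to_slice I)"
  unfolding to_slice_def by (intro continuous_intros)

lemma open_slice_preimage:
  assumes "openin slice_topology \<Omega>" and "I \<in> imag_units"
  shows "open (to_slice I -` \<Omega>)"
proof -
  have "openin (top_of_set (slice_space I)) (\<Omega> \<inter> slice_space I)"
    using assms by (simp add: openin_slice_topology)
  moreover have "to_slice I ` UNIV \<subseteq> slice_space I"
    by (auto simp: to_slice_def slice_space_def slice_plane_def) blast
  ultimately have "openin (top_of_set UNIV) (UNIV \<inter> to_slice I -` (\<Omega> \<inter> slice_space I))"
    using continuous_on_to_slice[of UNIV I] continuous_on_open_gen[of "to_slice I" UNIV]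
    by (metis image_subset_iff_funcset)
  moreover have "to_slice I -` (\<Omega> \<inter> slice_space I) = to_slice I -` \<Omega>"
    using \<open>to_slice I ` UNIV \<subseteq> slice_space I\<close> by auto
  ultimately show ?thesis
    by simp
qed

section \<open>Paths starting at real points\<close>

lemma units_along_iff:
  "I \<in> units_along \<Omega> \<gamma> \<longleftrightarrow> I \<in> imag_units \<and> path_image \<gamma> \<subseteq> to_slice I -` \<Omega>"
  by (auto simp: units_along_def path_image_def path_to_slice_def)

lemma pathfinish_path_to_slice: "pathfinish (path_to_slice I \<gamma>) = to_slice I (pathfinish \<gamma>)"
  by (simp add: pathfinish_def path_to_slice_def)

lemma unit_interval_restrict:
  "path_image (restrict p {0..1}) = path_image p"
  "pathstart (restrict p {0..1}) = pathstart p"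
  "pathfinish (restrict p {0..1}) = pathfinish p"
  "path (restrict p {0..1}) \<longleftrightarrow> path p"
  using continuous_on_cong[of "{0..1}" "{0..1}" "restrict p {0..1}" p]
  by (simp_all add: path_image_def pathstart_def pathfinish_def path_def)

lemma real_start_paths_join:
  assumes "\<alpha> \<in> real_start_paths" "path \<beta>" "pathstart \<beta> = pathfinish \<alpha>"
  shows "restrict (\<alpha> +++ \<beta>) {0..1} \<in> real_start_paths"
  using assms by (simp add: real_start_paths_def unit_interval_restrict)

lemma units_along_join:
  assumes "pathstart \<beta> = pathfinish \<alpha>"
  shows "units_along \<Omega> (restrict (\<alpha> +++ \<beta>) {0..1}) = units_along \<Omega> \<alpha> \<inter> units_along \<Omega> \<beta>"
  using assms by (auto simp: units_along_iff unit_interval_restrict path_image_join)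

text \<open>
  Passing to \<open>- I\<close> in the slice is the same as conjugating the path; restricting to the unit interval
  keeps the result among the paths considered.
\<close>

definition cnj_path :: "(real \<Rightarrow> complex^'n) \<Rightarrow> real \<Rightarrow> complex^'n" where
  "cnj_path \<gamma> = restrict (cnj_vec \<circ> \<gamma>) {0..1}"

lemma cnj_path_real_start:
  assumes "\<gamma> \<in> real_start_paths"
  shows "cnj_path \<gamma> \<in> real_start_paths"
proof -
  have "path \<gamma>" "pathstart \<gamma> \<in> real_points"
    using assms by (auto simp: real_start_paths_def)
  then show ?thesis
    by (simp add: real_start_paths_def cnj_path_def unit_interval_restrict pathstart_compose
        real_points_cnj_vec path_continuous_image continuous_on_cnj_vec)
qed

lemma pathfinish_cnj_path: "pathfinish (cnj_path \<gamma>) = cnj_vec (pathfinish \<gamma>)"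
  by (simp add: cnj_path_def unit_interval_restrict pathfinish_compose)

lemma units_along_cnj_path: "I \<in> units_along \<Omega> \<gamma> \<Longrightarrow> - I \<in> units_along \<Omega> (cnj_path \<gamma>)"
  by (auto simp: units_along_iff uminus_imag_unit cnj_path_def unit_interval_restrict
      path_image_compose to_slice_uminus)

lemma paths_in_iff: "\<gamma> \<in> paths_in \<Omega> \<longleftrightarrow> \<gamma> \<in> real_start_paths \<and> (\<exists>I. I \<in> units_along \<Omega> \<gamma>)"
  by (auto simp: paths_in_def)

text \<open>
  Real-path-connectedness provides a path only along some unit.  Off the real points that unit is
  \<open>\<plusminus>I\<close>, since a non-real point lies in exactly one slice, and conjugation repairs the sign; a real
  point is reached by the constant path.
\<close>

lemma real_path_connected_reach:
  fixes \<Omega> :: "(quat^('n::{finite,linorder})) set"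
  assumes "real_path_connected \<Omega>" and I: "I \<in> imag_units" and z: "to_slice I z \<in> \<Omega>"
  obtains \<gamma> where "\<gamma> \<in> real_start_paths" "I \<in> units_along \<Omega> \<gamma>" "pathfinish \<gamma> = z"
proof (cases "z \<in> real_points")
  case True
  let ?\<gamma> = "restrict (linepath z z) {0..1}"
  have "?\<gamma> \<in> real_start_paths"
    using True by (simp add: real_start_paths_def unit_interval_restrict)
  moreover have "I \<in> units_along \<Omega> ?\<gamma>"
    using I z by (simp add: units_along_iff unit_interval_restrict)
  ultimately show ?thesis
    using that by (simp add: unit_interval_restrict)
next
  case False
  obtain \<gamma> J where \<gamma>: "\<gamma> \<in> real_start_paths" "J \<in> units_along \<Omega> \<gamma>"
    and eq: "to_slice J (pathfinish \<gamma>) = to_slice I z"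
    using assms unfolding real_path_connected_def
    by (metis paths_in_iff pathfinish_path_to_slice)
  have J: "J \<in> imag_units"
    using \<gamma> by (simp add: units_along_iff)
  have "pathfinish \<gamma> \<notin> real_points"
    using False eq I J to_slice_real_points_iff by metis
  then have "slice_unit (to_slice I z) \<in> {I, - I} \<inter> {J, - J}"
    using slice_unit_to_slice[OF I False] slice_unit_to_slice[OF J, of "pathfinish \<gamma>"] eq
    by simp
  then have "I = J \<or> I = - J"
    by (auto simp: minus_equation_iff)
  then show ?thesis
  proof
    assume "I = J"
    then show ?thesis
      using that[of \<gamma>] \<gamma> eq I to_slice_eq_iff by metis
  next
    assume IJ: "I = - J"
    then have "cnj_vec (pathfinish \<gamma>) = z"
      using eq J by (simp add: to_slice_uminus to_slice_eq_iff)
    then show ?thesis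
      using that[of "cnj_path \<gamma>"] \<gamma> IJ
      by (simp add: cnj_path_real_start pathfinish_cnj_path units_along_cnj_path)
  qed
qed

section \<open>The Cauchy--Riemann equations as complex linearity\<close>

text \<open>
  The equations \<open>(\<partial>\<^sub>x + I \<partial>\<^sub>y) h = 0\<close> in all coordinates say that the derivative turns multiplication
  by \<open>i\<close> into left multiplication by \<open>I\<close>.  In this form no coordinates occur, so chain and product
  rules apply directly.
\<close>

definition left_holomorphic_at :: "quat \<Rightarrow> (complex^'n \<Rightarrow> quat) \<Rightarrow> complex^'n \<Rightarrow> bool" where
  "left_holomorphic_at I h z \<longleftrightarrow>
     (\<exists>D. (h has_derivative D) (at z) \<and> (\<forall>v. D (\<i> *s v) = I * D v))"

lemma left_holomorphic_diff:
  assumes "left_holomorphic_at I h z" and "left_holomorphic_at I k z"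
  shows "left_holomorphic_at I (\<lambda>w. h w - k w) z"
proof -
  obtain D E where "(h has_derivative D) (at z)" "(k has_derivative E) (at z)"
    and "\<And>v. D (\<i> *s v) = I * D v" "\<And>v. E (\<i> *s v) = I * E v"
    using assms unfolding left_holomorphic_at_def by blast
  then show ?thesis
    unfolding left_holomorphic_at_def
    by (intro exI[of _ "\<lambda>v. D v - E v"]) (simp add: has_derivative_diff right_diff_distrib)
qed

lemma left_holomorphic_cong_open:
  assumes "left_holomorphic_at I h z" and "open S" "z \<in> S" and "\<And>w. w \<in> S \<Longrightarrow> h w = k w"
  shows "left_holomorphic_at I k z"
  using assms has_derivative_transform_within_open[of h _ z UNIV S k]
  unfolding left_holomorphic_at_def by blast

lemma vector_derivative_along_line:
  fixes L :: "real \<Rightarrow> complex^'n"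
  assumes h: "(h has_derivative D) (at z)" and L: "bounded_linear L"
  shows "vector_derivative (\<lambda>t. h (z + L t)) (at 0) = D (L 1)"
proof -
  interpret L: bounded_linear L by (fact L)
  have "((\<lambda>t. z + L t) has_derivative L) (at 0)"
    using bounded_linear_imp_has_derivative[OF L] by (auto intro!: derivative_eq_intros)
  then have "((\<lambda>t. h (z + L t)) has_derivative (\<lambda>t. D (L t))) (at 0)"
    using has_derivative_compose[of "\<lambda>t. z + L t" L 0 UNIV h D] h by simp
  moreover have "D (L t) = t *\<^sub>R D (L 1)" for t
    using L.scaleR[of t 1] linear_cmul[OF has_derivative_linear[OF h]] by simp
  then have "(\<lambda>t. D (L t)) = (\<lambda>t. t *\<^sub>R D (L 1))"
    by blast
  ultimately show ?thesis
    by (intro vector_derivative_at) (simp only: has_vector_derivative_def)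
qed

lemma partial_eq_derivative:
  fixes z :: "complex^'n"
  assumes h: "(h has_derivative D) (at z)"
  shows "partial_x l h z = D (axis l 1)" and "partial_y l h z = D (axis l \<i>)"
proof -
  have "linear (\<lambda>t::real. axis l (of_real t * c) :: complex^'n)" for c
    by (rule linearI) (simp_all add: axis_def vec_eq_iff distrib_right flip: scaleR_conv_of_real)
  then have L: "bounded_linear (\<lambda>t::real. axis l (of_real t * c) :: complex^'n)" for c
    by (simp add: linear_conv_bounded_linear)
  show "partial_x l h z = D (axis l 1)" "partial_y l h z = D (axis l \<i>)"
    using vector_derivative_along_line[OF h L[of 1]] vector_derivative_along_line[OF h L[of \<i>]]
    by (simp_all add: partial_x_def partial_y_def)
qed

lemma left_linear_iff_axis:
  fixes D :: "complex^'n \<Rightarrow> quat"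
  assumes D: "linear D" and I: "I \<in> imag_units"
  shows "(\<forall>v. D (\<i> *s v) = I * D v) \<longleftrightarrow> (\<forall>l. D (axis l \<i>) = I * D (axis l 1))"
proof
  assume "\<forall>v. D (\<i> *s v) = I * D v"
  moreover have "\<i> *s axis l 1 = axis l \<i>" for l :: 'n
    by (simp add: vec_eq_iff axis_def)
  ultimately show "\<forall>l. D (axis l \<i>) = I * D (axis l 1)"
    by metis
next
  assume ax: "\<forall>l. D (axis l \<i>) = I * D (axis l 1)"
  show "\<forall>v. D (\<i> *s v) = I * D v"
  proof
    fix v :: "complex^'n"
    have v: "v = (\<Sum>l\<in>UNIV. Re (v $ l) *\<^sub>R axis l 1 + Im (v $ l) *\<^sub>R axis l \<i>)"
      by (simp add: vec_eq_iff axis_def complex_eq_iff if_distrib cong: if_cong)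
    have iv: "\<i> *s v = (\<Sum>l\<in>UNIV. Re (v $ l) *\<^sub>R axis l \<i> - Im (v $ l) *\<^sub>R axis l 1)"
      by (simp add: vec_eq_iff axis_def complex_eq_iff if_distrib cong: if_cong)
    have "D (\<i> *s v) = (\<Sum>l\<in>UNIV. Re (v $ l) *\<^sub>R D (axis l \<i>) - Im (v $ l) *\<^sub>R D (axis l 1))"
      unfolding iv using D by (simp add: linear_sum linear_diff linear_cmul)
    also have "\<dots> = I * (\<Sum>l\<in>UNIV. Re (v $ l) *\<^sub>R D (axis l 1) + Im (v $ l) *\<^sub>R D (axis l \<i>))"
      using ax I by (simp add: sum_distrib_left distrib_left imag_unit_square_left)
    also have "\<dots> = I * D v"
      by (subst (3) v) (use D in \<open>simp add: linear_sum linear_add linear_cmul\<close>)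
    finally show "D (\<i> *s v) = I * D v" .
  qed
qed

lemma slice_regular_iff_left_holomorphic:
  fixes \<Omega> :: "(quat^'n) set"
  shows "f \<in> slice_regular \<Omega> \<longleftrightarrow>
     (\<forall>I\<in>imag_units. \<forall>z\<in>to_slice I -` \<Omega>. left_holomorphic_at I (\<lambda>w. f (to_slice I w)) z)"
proof -
  have "(h differentiable (at z) \<and>
          (\<forall>l. (1/2) *\<^sub>R (partial_x l h z + I * partial_y l h z) = 0)) \<longleftrightarrow>
        left_holomorphic_at I h z" if I: "I \<in> imag_units" for I h and z :: "complex^'n"
  proof -
    have CR: "a + I * b = 0 \<longleftrightarrow> b = I * a" for a b
      using I by (metis add.commute add.right_inverse add_eq_0_iff2 imag_unit_square_left
          minus_minus mult_minus_right)
    have "(\<forall>l. (1/2) *\<^sub>R (partial_x l h z + I * partial_y l h z) = 0) \<longleftrightarrow>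
          (\<forall>v. D (\<i> *s v) = I * D v)" if D: "(h has_derivative D) (at z)" for D
      using left_linear_iff_axis[OF has_derivative_linear[OF D] I]
      by (simp add: partial_eq_derivative[OF D] CR)
    then show ?thesis
      unfolding left_holomorphic_at_def differentiable_def by blast
  qed
  then show ?thesis
    unfolding slice_regular_def slice_restrict_def by (simp add: Ball_def)
qed

section \<open>Stems recovered from two units\<close>

text \<open>
  For \<open>J \<noteq> K\<close> the system \<open>c + J d = a\<close>, \<open>c + K d = b\<close> has a unique solution, because \<open>J - K\<close> is
  invertible: \<open>d\<close> is \<open>stem_im J K a b\<close> and \<open>c\<close> is \<open>stem_re J K a b\<close>.
\<close>

definition stem_im :: "quat \<Rightarrow> quat \<Rightarrow> quat \<Rightarrow> quat \<Rightarrow> quat" where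
  "stem_im J K a b = inverse (J - K) * (a - b)"

definition stem_re :: "quat \<Rightarrow> quat \<Rightarrow> quat \<Rightarrow> quat \<Rightarrow> quat" where
  "stem_re J K a b = a - J * stem_im J K a b"

lemma stem_solve:
  assumes "J \<noteq> K"
  shows "c + J * d = a \<and> c + K * d = b \<longleftrightarrow> c = stem_re J K a b \<and> d = stem_im J K a b"
proof -
  have "(J - K) * d = e \<longleftrightarrow> d = inverse (J - K) * e" for e
    using assms by (metis left_inverse mult.assoc mult.left_neutral right_inverse
        right_minus_eq)
  then have d: "d = stem_im J K a b \<longleftrightarrow> (J - K) * d = a - b"
    by (simp add: stem_im_def)
  have c: "c + J * d = a \<longleftrightarrow> c = a - J * d"
    by (simp add: eq_diff_eq)
  have "a - J * d + K * d = b \<longleftrightarrow> (J - K) * d = a - b"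
    by (auto simp: algebra_simps)
  with c d show ?thesis
    unfolding stem_re_def by metis
qed

lemma stem_same: "stem_re J K a a = a" "stem_im J K a a = 0"
  by (simp_all add: stem_re_def stem_im_def)

text \<open>
  The solution \<open>(c, d)\<close> for data holomorphic with respect to \<open>J\<close> and \<open>K\<close> satisfies the classical
  Cauchy--Riemann equations \<open>c' (i v) = - d' v\<close> and \<open>d' (i v) = c' v\<close>: both pairs of derivatives solve
  the same linear system.  As \<open>c\<close> and \<open>d\<close> stand on the right of \<open>f\<close>, while \<open>I\<close> acts on the left, the
  product rule then gives holomorphy of \<open>f c + I f d\<close> with respect to \<open>I\<close>, although \<open>f\<close> and \<open>I\<close> need
  not commute.  With \<open>f = 1\<close> this is the holomorphy of \<open>c + I d\<close>.
\<close>

lemma left_holomorphic_stem_product: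
  assumes I: "I \<in> imag_units" and J: "J \<in> imag_units" and K: "K \<in> imag_units" and JK: "J \<noteq> K"
    and f: "left_holomorphic_at I f z"
    and a: "left_holomorphic_at J a z" and b: "left_holomorphic_at K b z"
  shows "left_holomorphic_at I
    (\<lambda>w. f w * stem_re J K (a w) (b w) + I * f w * stem_im J K (a w) (b w)) z"
proof -
  obtain F A B where F: "(f has_derivative F) (at z)" "\<And>v. F (\<i> *s v) = I * F v"
    and A: "(a has_derivative A) (at z)" "\<And>v. A (\<i> *s v) = J * A v"
    and B: "(b has_derivative B) (at z)" "\<And>v. B (\<i> *s v) = K * B v"
    using f a b unfolding left_holomorphic_at_def by blast
  define C where "C = (\<lambda>v. stem_re J K (A v) (B v))"
  define E where "E = (\<lambda>v. stem_im J K (A v) (B v))"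
  let ?c = "stem_re J K (a z) (b z)" and ?d = "stem_im J K (a z) (b z)"
  have d_im: "((\<lambda>w. stem_im J K (a w) (b w)) has_derivative E) (at z)"
    unfolding stem_im_def E_def
    by (intro has_derivative_mult_right has_derivative_diff A B)
  have d_re: "((\<lambda>w. stem_re J K (a w) (b w)) has_derivative C) (at z)"
    unfolding stem_re_def C_def E_def[symmetric]
    by (intro has_derivative_mult_right has_derivative_diff A d_im[unfolded E_def])
  have AB: "A v = C v + J * E v" "B v = C v + K * E v" for v
    using stem_solve[OF JK, of "C v" "E v" "A v" "B v"] by (auto simp: C_def E_def)
  \<comment> \<open>The pair \<open>(- E v, C v)\<close> solves the system whose right-hand sides are the derivatives of
      \<open>a\<close> and \<open>b\<close> in the direction \<open>i v\<close>.\<close>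
  have "- E v + J * C v = J * A v" "- E v + K * C v = K * B v" for v
    by (simp_all add: AB distrib_left imag_unit_square_left J K)
  then have CE: "C (\<i> *s v) = - E v" "E (\<i> *s v) = C v" for v
    using stem_solve[OF JK, of "- E v" "C v" "J * A v" "K * B v"]
    by (auto simp: C_def E_def A(2) B(2))
  let ?D = "\<lambda>v. (f z * C v + F v * ?c) + ((I * f z) * E v + (I * F v) * ?d)"
  have "((\<lambda>w. f w * stem_re J K (a w) (b w) + I * f w * stem_im J K (a w) (b w))
      has_derivative ?D) (at z)"
    by (intro has_derivative_add has_derivative_mult has_derivative_mult_right F d_re d_im)
  moreover have "?D (\<i> *s v) = I * ?D v" for v
    by (simp add: CE F(2) mult.assoc distrib_left imag_unit_square_left I)
  ultimately show ?thesis
    unfolding left_holomorphic_at_def by blast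
qed

section \<open>The identity theorem\<close>

lemma bounded_linear_complex_line:
  fixes v :: "complex^'n"
  shows "bounded_linear (\<lambda>s::complex. s *s v)"
proof -
  have "linear (\<lambda>s::complex. s *s v)"
    by (rule linearI) (simp_all add: vec_eq_iff algebra_simps)
  then show ?thesis
    by (simp add: linear_conv_bounded_linear)
qed

text \<open>
  The map \<open>q \<mapsto> \<langle>q, u\<rangle> - i \<langle>I q, u\<rangle>\<close> carries left multiplication by \<open>I\<close> to multiplication by \<open>i\<close>.  It
  therefore turns \<open>h\<close>, restricted to a complex line, into an ordinary holomorphic function of one
  variable, to which classical results apply.
\<close>

lemma left_holomorphic_scalar_part:
  assumes I: "I \<in> imag_units" and h: "left_holomorphic_at I h (z + \<zeta> *s v)"
  shows "(\<lambda>s. Complex (h (z + s *s v) \<bullet> u) (- ((I * h (z + s *s v)) \<bullet> u)))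
    field_differentiable at \<zeta>"
proof -
  obtain D where D: "(h has_derivative D) (at (z + \<zeta> *s v))" "\<And>w. D (\<i> *s w) = I * D w"
    using h unfolding left_holomorphic_at_def by blast
  define P where "P = (\<lambda>q. Complex (q \<bullet> u) (- ((I * q) \<bullet> u)))"
  have "linear P"
    unfolding P_def by (rule linearI) (auto simp: complex_eq_iff inner_add_left algebra_simps)
  then have P: "bounded_linear P"
    by (simp add: linear_conv_bounded_linear)
  have PI: "P (I * q) = \<i> * P q" for q
    using I by (simp add: P_def complex_eq_iff imag_unit_square_left)
  have "((\<lambda>s. z + s *s v) has_derivative (\<lambda>s. s *s v)) (at \<zeta>)"
    by (auto intro!: derivative_eq_intros
        bounded_linear_imp_has_derivative[OF bounded_linear_complex_line])
  then have "((\<lambda>s. h (z + s *s v)) has_derivative (\<lambda>s. D (s *s v))) (at \<zeta>)"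
    using has_derivative_compose[of "\<lambda>s. z + s *s v" "\<lambda>s. s *s v" \<zeta> UNIV h D] D(1) by simp
  then have "((\<lambda>s. P (h (z + s *s v))) has_derivative (\<lambda>s. P (D (s *s v)))) (at \<zeta>)"
    by (rule bounded_linear.has_derivative[OF P])
  moreover have "P (D (s *s v)) = P (D v) * s" for s
  proof -
    have s: "s *s v = Re s *\<^sub>R v + Im s *\<^sub>R (\<i> *s v)"
      by (simp add: vec_eq_iff complex_eq_iff)
    have "D (s *s v) = Re s *\<^sub>R D v + Im s *\<^sub>R (I * D v)"
      unfolding s using has_derivative_linear[OF D(1)] by (simp add: linear_add linear_cmul D(2))
    then show ?thesis
      using \<open>linear P\<close> by (simp add: linear_add linear_cmul PI complex_eq_iff)
  qed
  ultimately show ?thesis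
    unfolding P_def field_differentiable_def has_field_derivative_def by auto
qed

text \<open>
  Convexity of \<open>B\<close> makes the part of the complex line inside \<open>B\<close> connected, so the identity theorem in
  one variable carries the zeros from a real segment of parameters to the parameter \<open>c\<close>.
\<close>

lemma left_holomorphic_line_zero:
  fixes h :: "complex^'n \<Rightarrow> quat"
  assumes I: "I \<in> imag_units" and B: "open B" "convex B"
    and h: "\<And>z. z \<in> B \<Longrightarrow> left_holomorphic_at I h z"
    and a: "a \<in> B" "a + c *s v \<in> B"
    and zero: "\<And>t::real. a + of_real t *s v \<in> B \<Longrightarrow> \<bar>t\<bar> < e \<Longrightarrow> h (a + of_real t *s v) = 0"
    and e: "e > 0"
  shows "h (a + c *s v) = 0"
proof -
  let ?L = "\<lambda>s. a + s *s v"
  define S where "S = ?L -` B"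
  have contL: "continuous_on UNIV ?L"
    by (intro continuous_intros linear_continuous_on bounded_linear_complex_line)
  have "open S"
    unfolding S_def using contL B(1) by (simp add: open_vimage)
  moreover have "connected S"
  proof -
    have "S = (\<lambda>s. s *s v) -` ((\<lambda>x. - a + x) ` B)"
      by (force simp: S_def)
    then have "convex S"
      using B(2) bounded_linear_complex_line[of v]
      by (simp add: convex_linear_vimage convex_translation linear_conv_bounded_linear)
    then show ?thesis
      by (rule convex_connected)
  qed
  moreover define U where "U = of_real ` {t::real. \<bar>t\<bar> < e} \<inter> S"
  have "0 islimpt U"
  proof (subst islimpt_approachable, intro allI impI)
    fix r :: real assume "r > 0"
    have "0 \<in> S" using a by (simp add: S_def)
    then obtain k where k: "k > 0" "ball 0 k \<subseteq> S"
      using \<open>open S\<close> open_contains_ball by blast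
    define t where "t = min (min r k) e / 2"
    have "t > 0" "t < r" "t < k" "t < e"
      using \<open>r > 0\<close> k e by (auto simp: t_def)
    then have "complex_of_real t \<in> U"
      using k by (auto simp: U_def)
    then show "\<exists>x'\<in>U. x' \<noteq> 0 \<and> dist x' 0 < r"
      using \<open>t > 0\<close> \<open>t < r\<close> by (intro bexI[of _ "of_real t"]) auto
  qed
  moreover have "0 \<in> S" "c \<in> S" "U \<subseteq> S"
    using a by (auto simp: S_def U_def)
  moreover have U0: "h (?L s) = 0" if "s \<in> U" for s
    using that zero by (auto simp: U_def S_def)
  ultimately have "Complex (h (?L c) \<bullet> u) (- ((I * h (?L c)) \<bullet> u)) = 0" for u
  proof -
    let ?\<psi> = "\<lambda>s. Complex (h (?L s) \<bullet> u) (- ((I * h (?L s)) \<bullet> u))"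
    have "?\<psi> holomorphic_on S"
      unfolding holomorphic_on_def S_def
      using left_holomorphic_scalar_part[OF I h] field_differentiable_at_within by blast
    then show ?thesis
      using analytic_continuation[of ?\<psi> S U 0 c] \<open>open S\<close> \<open>connected S\<close> \<open>0 islimpt U\<close>
        \<open>0 \<in> S\<close> \<open>c \<in> S\<close> \<open>U \<subseteq> S\<close> U0 by (simp add: complex_eq_iff)
  qed
  \<comment> \<open>For \<open>u = h (?L c)\<close> the real part is the squared norm of the value in question.\<close>
  from this[of "h (?L c)"] show ?thesis
    by (simp add: complex_eq_iff)
qed

text \<open>
  Near a real point \<open>x\<close>, each \<open>a + i v\<close> lies on the complex line through \<open>a\<close> with real direction \<open>v\<close>,
  whose points with real parameter are real; so vanishing at real points forces vanishing on a
  ball.  From there zeros spread: if \<open>h\<close> vanishes near one point of a ball, it vanishes on every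
  complex line through that point, hence on the ball.
\<close>

lemma left_holomorphic_zero_from_real:
  fixes h :: "complex^'n \<Rightarrow> quat"
  assumes I: "I \<in> imag_units" and "open U"
    and h: "\<And>z. z \<in> U \<Longrightarrow> left_holomorphic_at I h z"
    and real: "\<And>z. z \<in> U \<Longrightarrow> z \<in> real_points \<Longrightarrow> h z = 0"
    and S: "connected S" "S \<subseteq> U" and x: "x \<in> S" "x \<in> real_points" and w: "w \<in> S"
  shows "h w = 0"
proof -
  define P where "P = (\<lambda>z. eventually (\<lambda>y. h y = 0) (nhds z))"
  have "P x"
  proof -
    obtain r where r: "r > 0" "ball x r \<subseteq> U"
      using \<open>open U\<close> S x open_contains_ball by (metis subsetD)
    have "h y = 0" if y: "y \<in> ball x r" for y
    proof -
      define a v :: "complex^'n"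
        where "a = (\<chi> l. of_real (Re (y $ l)))" and "v = (\<chi> l. of_real (Im (y $ l)))"
      have y_eq: "y = a + \<i> *s v"
        by (simp add: a_def v_def vec_eq_iff complex_eq_iff)
      have "norm (a - x) \<le> norm (y - x)"
      proof (rule norm_le_componentwise_cart)
        fix l
        have "Im (x $ l) = 0"
          using x by (auto simp: real_points_def complex_is_Real_iff)
        then have "(a - x) $ l = of_real (Re ((y - x) $ l))"
          by (simp add: a_def complex_eq_iff)
        then show "norm ((a - x) $ l) \<le> norm ((y - x) $ l)"
          using abs_Re_le_cmod[of "(y - x) $ l"] by (simp del: vector_minus_component)
      qed
      then have "a \<in> ball x r"
        using y by (simp add: dist_norm norm_minus_commute)
      moreover have "a + of_real t *s v \<in> real_points" for t
        by (simp add: real_points_def a_def v_def)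
      ultimately have "h (a + \<i> *s v) = 0"
        using left_holomorphic_line_zero[OF I open_ball convex_ball, of x r h a \<i> v 1]
          h[OF subsetD[OF r(2)]] real[OF subsetD[OF r(2)]] y[unfolded y_eq] by simp
      then show ?thesis
        by (simp add: y_eq)
    qed
    then show ?thesis
      unfolding P_def eventually_nhds using r(1)
      by (intro exI[of _ "ball x r"]) auto
  qed
  have "P w"
  proof (rule connected_induction_simple[OF S(1) x(1) w, of P])
    show "P x" by fact
    fix a assume "a \<in> S"
    then obtain r where r: "r > 0" "ball a r \<subseteq> U"
      using \<open>open U\<close> S open_contains_ball by (metis subsetD)
    have "P y" if xy: "p \<in> ball a r" "y \<in> ball a r" "P p" for p y
    proof -
      obtain e where e: "e > 0" "\<And>q. dist q p < e \<Longrightarrow> h q = 0"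
        using \<open>P p\<close> unfolding P_def eventually_nhds_metric by blast
      have "h q = 0" if q: "q \<in> ball a r" for q
      proof -
        define v where "v = q - p"
        \<comment> \<open>Parameters below \<open>k\<close> stay within distance \<open>e\<close> of \<open>p\<close>; adding 1 to the norm covers \<open>v = 0\<close>.\<close>
        define k where "k = e / (norm v + 1)"
        have "k > 0" using e by (simp add: k_def add_nonneg_pos)
        have "h (p + of_real t *s v) = 0" if "\<bar>t\<bar> < k" for t
        proof (rule e(2))
          have "of_real t *s v = t *\<^sub>R v"
            by (simp add: vec_eq_iff) (simp add: scaleR_conv_of_real)
          then have "dist (p + of_real t *s v) p = \<bar>t\<bar> * norm v"
            by (simp add: dist_norm)
          also have "\<dots> \<le> \<bar>t\<bar> * (norm v + 1)"
            by (simp add: mult_left_mono)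
          also have "\<dots> < e"
            using that by (simp add: k_def pos_less_divide_eq add_nonneg_pos)
          finally show "dist (p + of_real t *s v) p < e" .
        qed
        moreover have q_eq: "p + 1 *s v = q"
          by (simp add: v_def)
        ultimately have "h (p + 1 *s v) = 0"
          using left_holomorphic_line_zero[OF I open_ball convex_ball, of a r h p 1 v k]
            h[OF subsetD[OF r(2)]] xy(1) q \<open>k > 0\<close> unfolding q_eq by blast
        then show ?thesis
          unfolding q_eq .
      qed
      then show ?thesis
        unfolding P_def eventually_nhds using xy(2) open_ball by blast
    qed
    then have "\<forall>x\<in>S \<inter> ball a r. \<forall>y\<in>S \<inter> ball a r. P x \<longrightarrow> P y"
      by blast
    moreover have "openin (top_of_set S) (S \<inter> ball a r)" "a \<in> S \<inter> ball a r"
      using \<open>a \<in> S\<close> r by (auto simp: openin_open_Int)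
    ultimately show "\<exists>T. openin (top_of_set S) T \<and> a \<in> T \<and> (\<forall>x\<in>T. \<forall>y\<in>T. P x \<longrightarrow> P y)"
      by blast
  qed
  then show ?thesis
    unfolding P_def by (rule eventually_nhds_x_imp_x)
qed

section \<open>Slice regular functions are path-slice\<close>

text \<open>
  Both sides are holomorphic with respect to \<open>I\<close> on the open set of points whose \<open>I\<close>-, \<open>J\<close>- and
  \<open>K\<close>-lifts lie in \<open>\<Omega>\<close>.  They agree at its real points, where the three lifts coincide, and the
  path is a connected subset of that open set starting at a real point.
\<close>

lemma slice_regular_representation:
  fixes g :: "quat^'n \<Rightarrow> quat"
  assumes \<Omega>: "openin slice_topology \<Omega>" and g: "g \<in> slice_regular \<Omega>"
    and \<gamma>: "\<gamma> \<in> real_start_paths"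
    and units: "I \<in> units_along \<Omega> \<gamma>" "J \<in> units_along \<Omega> \<gamma>" "K \<in> units_along \<Omega> \<gamma>" and JK: "J \<noteq> K"
  defines "z \<equiv> pathfinish \<gamma>"
  shows "g (to_slice I z) = stem_re J K (g (to_slice J z)) (g (to_slice K z))
    + I * stem_im J K (g (to_slice J z)) (g (to_slice K z))"
proof -
  let ?U = "to_slice I -` \<Omega> \<inter> to_slice J -` \<Omega> \<inter> to_slice K -` \<Omega>"
  let ?rep = "\<lambda>z. stem_re J K (g (to_slice J z)) (g (to_slice K z))
    + I * stem_im J K (g (to_slice J z)) (g (to_slice K z))"
  let ?h = "\<lambda>z. g (to_slice I z) - ?rep z"
  have IJK: "I \<in> imag_units" "J \<in> imag_units" "K \<in> imag_units"
    and sub: "path_image \<gamma> \<subseteq> ?U"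
    using units by (auto simp: units_along_iff)
  have "open ?U"
    using IJK \<Omega> by (intro open_Int open_slice_preimage)
  moreover have "left_holomorphic_at I ?h y" if "y \<in> ?U" for y
  proof -
    have gy: "left_holomorphic_at L (\<lambda>w. g (to_slice L w)) y" if "L \<in> {I, J, K}" for L
      using g IJK \<open>y \<in> ?U\<close> that unfolding slice_regular_iff_left_holomorphic by blast
    have "left_holomorphic_at I (\<lambda>w. 1) y"
      unfolding left_holomorphic_at_def by (intro exI[of _ "\<lambda>v. 0"]) simp
    then have "left_holomorphic_at I ?rep y"
      using left_holomorphic_stem_product[OF IJK JK, of "\<lambda>w. 1"
          y "\<lambda>w. g (to_slice J w)" "\<lambda>w. g (to_slice K w)"] gy by simp
    moreover have "left_holomorphic_at I (\<lambda>w. g (to_slice I w)) y"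
      using gy by simp
    ultimately show ?thesis
      by (intro left_holomorphic_diff)
  qed
  moreover have "?h y = 0" if "y \<in> real_points" for y
    using to_slice_real[OF that, of J I] to_slice_real[OF that, of K I] by (simp add: stem_same)
  moreover have "path \<gamma>" "pathstart \<gamma> \<in> real_points"
    using \<gamma> by (auto simp: real_start_paths_def)
  ultimately have "?h z = 0"
    using left_holomorphic_zero_from_real[OF IJK(1), of ?U ?h "path_image \<gamma>" "pathstart \<gamma>" z] sub
    by (simp add: connected_path_image z_def pathstart_in_path_image pathfinish_in_path_image)
  then show ?thesis
    by simp
qed

text \<open>
  If two units are available along a path, they determine the stem and the representation formula
  extends it to all others; if there is only one unit, its value can be taken as the first component.
\<close>

theorem slice_regular_subset_path_slice:
  assumes \<Omega>: "openin slice_topology \<Omega>"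
  shows "slice_regular \<Omega> \<subseteq> path_slice \<Omega>"
proof
  fix g assume g: "g \<in> slice_regular \<Omega>"
  have "\<exists>p. \<forall>I\<in>units_along \<Omega> \<gamma>. g (to_slice I (pathfinish \<gamma>)) = row_times_col (1, I) p"
    if \<gamma>: "\<gamma> \<in> paths_in \<Omega>" for \<gamma>
  proof (cases "\<exists>J\<in>units_along \<Omega> \<gamma>. \<exists>K\<in>units_along \<Omega> \<gamma>. J \<noteq> K")
    case True
    then obtain J K where JK: "J \<in> units_along \<Omega> \<gamma>" "K \<in> units_along \<Omega> \<gamma>" "J \<noteq> K"
      by blast
    let ?z = "pathfinish \<gamma>"
    let ?p = "(stem_re J K (g (to_slice J ?z)) (g (to_slice K ?z)),
      stem_im J K (g (to_slice J ?z)) (g (to_slice K ?z)))"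
    show ?thesis
      using slice_regular_representation[OF \<Omega> g _ _ JK] \<gamma>
      by (intro exI[of _ ?p]) (auto simp: paths_in_iff)
  next
    case False
    then obtain I where "units_along \<Omega> \<gamma> \<subseteq> {I}"
      by blast
    then show ?thesis
      by (intro exI[of _ "(g (to_slice I (pathfinish \<gamma>)), 0)"]) auto
  qed
  then obtain F where "\<And>\<gamma>. \<gamma> \<in> paths_in \<Omega> \<Longrightarrow>
      \<forall>I\<in>units_along \<Omega> \<gamma>. g (to_slice I (pathfinish \<gamma>)) = row_times_col (1, I) (F \<gamma>)"
    by metis
  then show "g \<in> path_slice \<Omega>"
    by (auto simp: path_slice_def path_slice_stem_def pathfinish_path_to_slice)
qed

section \<open>Well-definedness of the star product\<close>

lemma stem_preserving_two_units:
  assumes "stem_preserving \<Omega>\<^sub>1 \<Omega>\<^sub>2" and "\<gamma> \<in> paths_in \<Omega>\<^sub>1"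
  obtains J K where "J \<in> units_along \<Omega>\<^sub>2 \<gamma>" "K \<in> units_along \<Omega>\<^sub>2 \<gamma>" "J \<noteq> K"
proof -
  let ?U = "units_along \<Omega>\<^sub>2 \<gamma>"
  have "\<not> (\<exists>I. ?U \<subseteq> {I})"
  proof
    assume "\<exists>I. ?U \<subseteq> {I}"
    then obtain I where "?U \<subseteq> {I}" by blast
    then have "finite ?U" "card ?U \<le> 1"
      using finite_subset[of ?U "{I}"] card_mono[of "{I}" ?U] by auto
    with assms show False
      unfolding stem_preserving_def by fastforce
  qed
  then show ?thesis
    using that by blast
qed

lemma path_slice_stem_eq:
  assumes G: "path_slice_stem \<Omega> g G" and \<gamma>: "\<gamma> \<in> real_start_paths"
    and JK: "J \<in> units_along \<Omega> \<gamma>" "K \<in> units_along \<Omega> \<gamma>" "J \<noteq> K"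
  shows "G \<gamma> = (stem_re J K (g (to_slice J (pathfinish \<gamma>))) (g (to_slice K (pathfinish \<gamma>))),
    stem_im J K (g (to_slice J (pathfinish \<gamma>))) (g (to_slice K (pathfinish \<gamma>))))"
proof -
  obtain c d where cd: "G \<gamma> = (c, d)"
    by fastforce
  have "\<gamma> \<in> paths_in \<Omega>"
    using \<gamma> JK by (auto simp: paths_in_iff)
  then have "c + J * d = g (to_slice J (pathfinish \<gamma>))" "c + K * d = g (to_slice K (pathfinish \<gamma>))"
    using G JK by (simp_all add: path_slice_stem_def pathfinish_path_to_slice cd)
  then show ?thesis
    using stem_solve[OF JK(3), of c d "g (to_slice J (pathfinish \<gamma>))"
        "g (to_slice K (pathfinish \<gamma>))"]
    by (simp add: cd)
qed

text \<open>
  The stems of \<open>\<alpha>\<close> and \<open>\<beta>\<close> agree as soon as two units are common to both in \<open>\<Omega>\<^sub>2\<close>.  Running along \<open>\<alpha>\<close>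
  and back along \<open>\<beta>\<close> yields one path, in \<open>\<Omega>\<^sub>1\<close> along \<open>I\<close>, whose units are exactly the common ones;
  stem preservation for this path provides the two units.
\<close>

lemma path_slice_stem_endpoint:
  assumes sp: "stem_preserving \<Omega>\<^sub>1 \<Omega>\<^sub>2" and G: "path_slice_stem \<Omega>\<^sub>2 g G"
    and \<alpha>: "\<alpha> \<in> real_start_paths" "I \<in> units_along \<Omega>\<^sub>1 \<alpha>"
    and \<beta>: "\<beta> \<in> real_start_paths" "I \<in> units_along \<Omega>\<^sub>1 \<beta>"
    and eq: "pathfinish \<alpha> = pathfinish \<beta>"
  shows "G \<alpha> = G \<beta>"
proof -
  let ?\<delta> = "restrict (\<alpha> +++ reversepath \<beta>) {0..1}"
  have rev: "units_along \<Omega> (reversepath \<beta>) = units_along \<Omega> \<beta>" for \<Omega>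
    by (simp add: set_eq_iff units_along_iff)
  have units: "units_along \<Omega> ?\<delta> = units_along \<Omega> \<alpha> \<inter> units_along \<Omega> \<beta>" for \<Omega>
    using eq by (simp add: units_along_join rev)
  have "path \<beta>"
    using \<beta> by (simp add: real_start_paths_def)
  then have "?\<delta> \<in> paths_in \<Omega>\<^sub>1"
    using \<alpha> \<beta> eq by (auto simp: paths_in_iff units intro!: real_start_paths_join)
  then obtain J K where "J \<in> units_along \<Omega>\<^sub>2 ?\<delta>" "K \<in> units_along \<Omega>\<^sub>2 ?\<delta>" "J \<noteq> K"
    using stem_preserving_two_units[OF sp] by blast
  then show ?thesis
    using path_slice_stem_eq[OF G \<alpha>(1), of J K] path_slice_stem_eq[OF G \<beta>(1), of J K] eq
    by (simp add: units)
qed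

lemma path_slice_stem_cnj_path:
  assumes sp: "stem_preserving \<Omega>\<^sub>1 \<Omega>\<^sub>2" and G: "path_slice_stem \<Omega>\<^sub>2 g G" and \<gamma>: "\<gamma> \<in> paths_in \<Omega>\<^sub>1"
  shows "G (cnj_path \<gamma>) = (fst (G \<gamma>), - snd (G \<gamma>))"
proof -
  obtain J K where JK: "J \<in> units_along \<Omega>\<^sub>2 \<gamma>" "K \<in> units_along \<Omega>\<^sub>2 \<gamma>" "J \<noteq> K"
    using stem_preserving_two_units[OF sp \<gamma>] .
  have \<gamma>': "\<gamma> \<in> real_start_paths"
    using \<gamma> by (simp add: paths_in_iff)
  define a b where "a = g (to_slice J (pathfinish \<gamma>))" and "b = g (to_slice K (pathfinish \<gamma>))"
  have "G (cnj_path \<gamma>) = (stem_re (- J) (- K) a b, stem_im (- J) (- K) a b)"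
    using path_slice_stem_eq[OF G cnj_path_real_start[OF \<gamma>'] units_along_cnj_path[OF JK(1)]
        units_along_cnj_path[OF JK(2)]] JK(3)
    by (simp add: pathfinish_cnj_path to_slice_uminus a_def b_def)
  moreover have "G \<gamma> = (stem_re J K a b, stem_im J K a b)"
    using path_slice_stem_eq[OF G \<gamma>' JK] by (simp add: a_def b_def)
  moreover have "stem_im (- J) (- K) a b = - stem_im J K a b"
  proof -
    have "- J - - K = - (J - K)" by simp
    then show ?thesis
      unfolding stem_im_def by (metis inverse_minus_eq mult_minus_left)
  qed
  ultimately show ?thesis
    by (simp add: stem_re_def)
qed

text \<open>
  The formula holds whichever unit the definition of the star product picks.  At a real point the three values
  \<open>g (to_slice J z)\<close>, \<open>g (to_slice K z)\<close>, \<open>g (to_slice I z)\<close> coincide, so the stem is \<open>(g q, 0)\<close>.  At a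
  non-real point whose unit is \<open>- I\<close>, the conjugate path has stem \<open>(c, - d)\<close>, and the two signs cancel.
\<close>

lemma star_product_along_path:
  fixes \<Omega>\<^sub>1 \<Omega>\<^sub>2 :: "(quat^('n::{finite,linorder})) set"
  assumes sp: "stem_preserving \<Omega>\<^sub>1 \<Omega>\<^sub>2"
    and "g \<in> path_slice \<Omega>\<^sub>2"
    and \<gamma>: "\<gamma> \<in> real_start_paths" "I \<in> units_along \<Omega>\<^sub>1 \<gamma>"
    and JK: "J \<in> units_along \<Omega>\<^sub>2 \<gamma>" "K \<in> units_along \<Omega>\<^sub>2 \<gamma>" "J \<noteq> K"
  defines "z \<equiv> pathfinish \<gamma>"
  shows "star_product \<Omega>\<^sub>1 \<Omega>\<^sub>2 f g (to_slice I z) =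
    f (to_slice I z) * stem_re J K (g (to_slice J z)) (g (to_slice K z))
    + I * f (to_slice I z) * stem_im J K (g (to_slice J z)) (g (to_slice K z))"
proof (cases "z \<in> real_points")
  case True
  have I: "I \<in> imag_units"
    using \<gamma> by (simp add: units_along_iff)
  have "to_slice I z \<in> real_points"
    using True I by (simp add: to_slice_real_points_iff)
  then have "star_product \<Omega>\<^sub>1 \<Omega>\<^sub>2 f g (to_slice I z) = f (to_slice I z) * g (to_slice I z)"
    by (simp add: star_product_def stem_at_def)
  moreover have "to_slice J z = to_slice I z" "to_slice K z = to_slice I z"
    using True by (rule to_slice_real)+
  ultimately show ?thesis
    by (simp only: stem_same mult_zero_right add_0_right)
next
  case False
  define q where "q = to_slice I z"
  define G where "G = (SOME G. path_slice_stem \<Omega>\<^sub>2 g G)"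
  have "\<exists>G. path_slice_stem \<Omega>\<^sub>2 g G"
    using \<open>g \<in> path_slice \<Omega>\<^sub>2\<close> by (simp add: path_slice_def)
  then have G: "path_slice_stem \<Omega>\<^sub>2 g G"
    unfolding G_def by (rule someI_ex)
  have I: "I \<in> imag_units"
    using \<gamma> by (simp add: units_along_iff)
  have \<gamma>in: "\<gamma> \<in> paths_in \<Omega>\<^sub>1"
    using \<gamma> by (auto simp: paths_in_iff)
  define L where "L = slice_unit q"
  have L: "L = I \<or> L = - I"
    using slice_unit_to_slice[OF I False] by (simp add: L_def q_def)
  define \<beta> where "\<beta> = (if L = I then \<gamma> else cnj_path \<gamma>)"
  have \<beta>: "\<beta> \<in> real_start_paths" "L \<in> units_along \<Omega>\<^sub>1 \<beta>" "to_slice L (pathfinish \<beta>) = q"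
    using L \<gamma> by (auto simp: \<beta>_def cnj_path_real_start units_along_cnj_path pathfinish_cnj_path
        to_slice_uminus q_def z_def)
  have L_unit: "L \<in> imag_units"
    using \<beta> by (simp add: units_along_iff)
  let ?good = "\<lambda>\<alpha>. \<alpha> \<in> paths_in \<Omega>\<^sub>1 \<and> path_image (path_to_slice L \<alpha>) \<subseteq> \<Omega>\<^sub>1 \<and>
    pathfinish (path_to_slice L \<alpha>) = q"
  have good_iff: "?good \<alpha> \<longleftrightarrow>
      \<alpha> \<in> real_start_paths \<and> L \<in> units_along \<Omega>\<^sub>1 \<alpha> \<and> to_slice L (pathfinish \<alpha>) = q" for \<alpha>
    using L_unit by (auto simp: paths_in_iff units_along_def pathfinish_path_to_slice)
  define \<alpha> where "\<alpha> = (SOME \<alpha>. ?good \<alpha>)"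
  have "?good \<beta>"
    using \<beta> good_iff by blast
  then have "?good \<alpha>"
    unfolding \<alpha>_def by (rule someI[of ?good])
  then have \<alpha>: "\<alpha> \<in> real_start_paths" "L \<in> units_along \<Omega>\<^sub>1 \<alpha>" "to_slice L (pathfinish \<alpha>) = q"
    and \<alpha>in: "\<alpha> \<in> paths_in \<Omega>\<^sub>1"
    using good_iff by blast+
  have "pathfinish \<alpha> = pathfinish \<beta>"
    using \<alpha>(3) \<beta>(3) L_unit to_slice_eq_iff by metis
  then have "G \<alpha> = G \<beta>"
    using path_slice_stem_endpoint[OF sp G] \<alpha> \<beta> by blast
  moreover have "stem_at \<Omega>\<^sub>1 \<Omega>\<^sub>2 g q = G \<alpha>"
  proof -
    have "q \<notin> real_points"
      using False I by (simp add: q_def to_slice_real_points_iff)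
    then show ?thesis
      unfolding stem_at_def stem_on_def L_def[symmetric] G_def[symmetric] \<alpha>_def[symmetric]
      using \<alpha>in by simp
  qed
  ultimately have "star_product \<Omega>\<^sub>1 \<Omega>\<^sub>2 f g q = f q * fst (G \<beta>) + L * f q * snd (G \<beta>)"
    unfolding star_product_def L_def by (cases "G \<beta>") simp
  also have "\<dots> = f q * fst (G \<gamma>) + I * f q * snd (G \<gamma>)"
    using L path_slice_stem_cnj_path[OF sp G \<gamma>in] by (auto simp: \<beta>_def)
  finally show ?thesis
    using path_slice_stem_eq[OF G \<gamma>(1) JK] by (simp add: q_def z_def)
qed

section \<open>Slice regularity of the star product\<close>

theorem theorem4p3:
  fixes \<Omega>\<^sub>1 \<Omega>\<^sub>2 :: "(quat^('n::{finite,linorder})) set"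
    and f g :: "quat^('n::{finite,linorder}) \<Rightarrow> quat"
  assumes "openin slice_topology \<Omega>\<^sub>1" and "real_path_connected \<Omega>\<^sub>1"
    and "openin slice_topology \<Omega>\<^sub>2" and "stem_preserving \<Omega>\<^sub>1 \<Omega>\<^sub>2"
    and "f \<in> slice_regular \<Omega>\<^sub>1" and "g \<in> slice_regular \<Omega>\<^sub>2"
  shows "star_product \<Omega>\<^sub>1 \<Omega>\<^sub>2 f g \<in> slice_regular \<Omega>\<^sub>1"
  unfolding slice_regular_iff_left_holomorphic
proof (intro ballI)
  fix I and z :: "complex^('n::{finite,linorder})"
  assume I: "I \<in> imag_units" and "z \<in> to_slice I -` \<Omega>\<^sub>1"
  then obtain \<gamma> where \<gamma>: "\<gamma> \<in> real_start_paths" "I \<in> units_along \<Omega>\<^sub>1 \<gamma>" "pathfinish \<gamma> = z"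
    using real_path_connected_reach[OF assms(2) I] by auto
  then obtain J K where JK: "J \<in> units_along \<Omega>\<^sub>2 \<gamma>" "K \<in> units_along \<Omega>\<^sub>2 \<gamma>" "J \<noteq> K"
    using stem_preserving_two_units[OF assms(4), of \<gamma>] by (auto simp: paths_in_iff)
  let ?U = "to_slice I -` \<Omega>\<^sub>1 \<inter> to_slice J -` \<Omega>\<^sub>2 \<inter> to_slice K -` \<Omega>\<^sub>2"
  let ?h = "\<lambda>w. f (to_slice I w) * stem_re J K (g (to_slice J w)) (g (to_slice K w))
    + I * f (to_slice I w) * stem_im J K (g (to_slice J w)) (g (to_slice K w))"
  have units: "J \<in> imag_units" "K \<in> imag_units"
    using JK by (auto simp: units_along_iff)
  have "z \<in> path_image \<gamma>"
    using \<gamma> by (metis pathfinish_in_path_image)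
  then have z: "z \<in> ?U"
    using \<gamma> JK by (auto simp: units_along_iff)
  moreover have "open ?U"
    using assms I units by (intro open_Int open_slice_preimage)
  ultimately obtain r where r: "r > 0" "ball z r \<subseteq> ?U"
    using open_contains_ball by blast
  have local: "star_product \<Omega>\<^sub>1 \<Omega>\<^sub>2 f g (to_slice I w) = ?h w" if w: "w \<in> ball z r" for w
  proof -
    let ?\<delta> = "restrict (\<gamma> +++ linepath z w) {0..1}"
    have "closed_segment z w \<subseteq> ?U"
      using closed_segment_subset[of z "ball z r" w] w r by auto
    then have "I \<in> units_along \<Omega>\<^sub>1 ?\<delta>" "J \<in> units_along \<Omega>\<^sub>2 ?\<delta>" "K \<in> units_along \<Omega>\<^sub>2 ?\<delta>"
      using \<gamma> JK I units by (auto simp: units_along_join) (auto simp: units_along_iff)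
    moreover have "?\<delta> \<in> real_start_paths"
      using \<gamma> by (simp add: real_start_paths_join)
    moreover have "pathfinish ?\<delta> = w"
      by (simp add: unit_interval_restrict)
    moreover have "g \<in> path_slice \<Omega>\<^sub>2"
      using assms slice_regular_subset_path_slice by blast
    ultimately show ?thesis
      using star_product_along_path[OF assms(4), of g ?\<delta> I J K f] JK(3) by simp
  qed
  have "left_holomorphic_at I ?h z"
    using assms(5,6) I units JK(3) z
    by (intro left_holomorphic_stem_product)
      (auto simp: slice_regular_iff_left_holomorphic)
  then show "left_holomorphic_at I (\<lambda>w. star_product \<Omega>\<^sub>1 \<Omega>\<^sub>2 f g (to_slice I w)) z"
    by (rule left_holomorphic_cong_open[where S = "ball z r"]) (use local r(1) in auto)
qed

end
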